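(* Let $2\leq d\leq n-1$ and let $T$ be a tree with $n$ vertices and diameter $d$. Then $$SO_{1}(T)\leq \frac{1}{2}(n-d+1)\big((n-d+1)^{2}-1\big),$$ with equality if and only if $T\cong T_{n,d}^{i}$ for some $i\in\{1,2,\ldots,\lfloor d/2\rfloor\}$.
   Context: All graphs are finite and simple. For a graph $G$, $d_u$ is the degree of the vertex $u$, and $SO_{1}(G)=\frac{1}{2}\sum_{uv\in E(G)}|d_{u}^{2}-d_{v}^{2}|$. The tree $T_{n,d}^{i}$ is obtained from the path $v_{0}v_{1}\cdots v_{d}$ by attaching $n-d-1$ pendent edges $v_iu_1,\ldots,v_iu_{n-d-1}$ (with new vertices $u_1,\dots,u_{n-d-1}$) to the vertex $v_{i}$. *)

theory Defs
  imports "Graph_Theory.Graph_Theory"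
begin

text \<open>
  A finite simple graph is a \<^locale>\<open>pair_graph\<close>: a finite, loop-free, symmetric digraph without
  parallel arcs, in which an edge \<open>uv\<close> is represented by the two arcs \<open>(u, v)\<close> and \<open>(v, u)\<close>.
  Hence the degree of a vertex is its \<^const>\<open>out_degree\<close>, and for such graphs
  \<^const>\<open>digraph_iso\<close> is ordinary graph isomorphism.
\<close>

text \<open>
  In a symmetric digraph every edge yields the closed walk \<open>u, v, u\<close>, which
  \<^const>\<open>pre_digraph.cycle\<close> admits. The cycles of the undirected graph are those of length at
  least 3; therefore the predicate \<^const>\<open>tree\<close> of the library cannot be used here.
\<close>

definition undirected_tree :: "'a pair_pre_digraph \<Rightarrow> bool" where
  "undirected_tree G \<longleftrightarrow> pair_graph G \<and> connected (with_proj G) \<and>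
     \<not> (\<exists>p. pre_digraph.cycle (with_proj G) p \<and> 3 \<le> length p)"

definition dist_graph :: "'a pair_pre_digraph \<Rightarrow> 'a \<Rightarrow> 'a \<Rightarrow> ereal" where
  "dist_graph G u v = wf_digraph.\<mu> (with_proj G) (\<lambda>_. 1) u v"

definition diameter_graph :: "'a pair_pre_digraph \<Rightarrow> ereal" where
  "diameter_graph G = (SUP u\<in>pverts G. SUP v\<in>pverts G. dist_graph G u v)"

text \<open>
  The sum over arcs counts every edge twice (the summand is symmetric in \<open>u\<close> and \<open>v\<close>), so half of
  it is the sum over the edges; the outer factor \<open>1/2\<close> belongs to the definition of the index.
\<close>

definition SO1 :: "'a pair_pre_digraph \<Rightarrow> real" where
  "SO1 G = 1 / 2 * ((\<Sum>(u, v)\<in>parcs G.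
      \<bar>real (out_degree (with_proj G) u) ^ 2 - real (out_degree (with_proj G) v) ^ 2\<bar>) / 2)"

text \<open>
  The tree \<open>T\<^bsub>n,d\<^esub>\<^bsup>i\<^esup>\<close>: the path vertex \<open>v\<^sub>j\<close> is the number \<open>j\<close> (\<open>0 \<le> j \<le> d\<close>) and the pendent
  vertex \<open>u\<^sub>k\<close> is the number \<open>d + k\<close> (\<open>1 \<le> k \<le> n - d - 1\<close>).
\<close>

definition path_with_pendents :: "nat \<Rightarrow> nat \<Rightarrow> nat \<Rightarrow> nat pair_pre_digraph" where
  "path_with_pendents n d i =
     (let E = {(j, j + 1) | j. j < d} \<union> {(i, d + k) | k. 1 \<le> k \<and> k \<le> n - d - 1}
      in \<lparr> pverts = {0..d} \<union> {d + k | k. 1 \<le> k \<and> k \<le> n - d - 1}, parcs = E \<union> E\<inverse> \<rparr>)"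

end

theory Submission
  imports Defs
begin

text \<open>
  For adjacent vertices of degrees \<open>a\<close> and \<open>b\<close> one has \<open>\<bar>a\<^sup>2 - b\<^sup>2\<bar> \<le> w a + w b\<close>, where
  \<open>w x = x\<^sup>2 - 4\<close> for \<open>x \<ge> 2\<close> and \<open>w 1 = 3\<close>, with equality unless both degrees are at least 3 or
  both are 1. Summing over the edges bounds the index by half the sum of \<open>a w(a)\<close> over all
  vertices. A leaf contributes 3 to this sum, and a vertex of degree \<open>x + 2\<close> contributes
  \<open>x\<^sup>3 + 6x\<^sup>2 + 8x\<close>. This cubic is superadditive, and in a tree with \<open>L\<close> leaves the excesses \<open>x\<close>
  add up to \<open>L - 2\<close>; hence the index is at most \<open>(L\<^sup>3 - L) / 2\<close>, with equality exactly when at most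
  one vertex has degree at least 3. The \<open>d - 1\<close> inner vertices of a diametral path are not leaves,
  so \<open>L \<le> n - d + 1\<close>. If both bounds are attained, every vertex outside the path is a leaf attached
  to the same inner vertex.
\<close>

section \<open>Trees\<close>

text \<open>Since \<open>h\<close> drops from each vertex to its parent, no arc of \<open>F\<close>
  is the reverse of another, so \<open>F\<close> and its converse are disjoint. This counts the arcs
  both of an arbitrary tree and of \<open>path_with_pendents\<close>.\<close>

lemma card_symmetric_parent_arcs:
  fixes h :: "'a \<Rightarrow> nat"
  assumes "finite S" and less: "\<And>v. v \<in> S \<Longrightarrow> h (parent v) < h v"
    and F: "F = (\<lambda>v. (v, parent v)) ` S"
  shows "card (F \<union> F\<inverse>) = 2 * card S"
proof -
  have "h (snd e) < h (fst e)" if "e \<in> F" for e using that less by (auto simp: F)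
  then have "\<not> ((u, v) \<in> F \<and> (v, u) \<in> F)" for u v
    by (metis fst_conv snd_conv less_asym)
  then have "F \<inter> F\<inverse> = {}" by auto
  moreover have "card F = card S"
    unfolding F by (intro card_image) (auto simp: inj_on_def)
  moreover have "finite F" using assms by simp
  ultimately show ?thesis by (simp add: card_Un_disjoint)
qed

locale undirected_tree_graph = pair_graph G for G :: "'a pair_pre_digraph" (structure) +
  assumes conn: "connected (with_proj G)"
    and acyc: "cycle p \<Longrightarrow> length p < 3"
begin

lemma reachable_all:
  assumes "u \<in> pverts G" "v \<in> pverts G"
  shows "u \<rightarrow>\<^sup>*\<^bsub>with_proj G\<^esub> v"
proof -
  have "strongly_connected (with_proj G)"
    using symmetric_connected_imp_strongly_connected[OF pair_sym_arcs conn] .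
  then show ?thesis using assms by (auto simp: strongly_connected_def)
qed

lemma pverts_nonempty: "pverts G \<noteq> {}"
  using conn by (auto simp: connected_conv)

text \<open>\<open>h\<close> is the distance to the root \<open>r\<close>, and \<open>parent\<close>
  picks the next vertex on a shortest walk to \<open>r\<close>.\<close>

lemma ex_parent_function:
  assumes r: "r \<in> pverts G"
  obtains h :: "'a \<Rightarrow> nat" and parent
  where "\<And>v. v \<in> pverts G - {r} \<Longrightarrow> (v, parent v) \<in> parcs G \<and> h v = Suc (h (parent v))"
proof -
  define h where "h v = (LEAST k. \<exists>p. awalk v p r \<and> length p = k)" for v
  have "\<exists>w. (v, w) \<in> parcs G \<and> h v = Suc (h w)" if v: "v \<in> pverts G - {r}" for v
  proof -
    have "\<exists>k p. awalk v p r \<and> length p = k"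
      using reachable_all[OF _ r, of v] v by (auto simp: reachable_awalk)
    then have "\<exists>p. awalk v p r \<and> length p = h v"
      unfolding h_def by (rule LeastI_ex)
    then obtain p where p: "awalk v p r" "length p = h v" by blast
    with v obtain e q where e: "p = e # q" by (cases p) (auto simp: awalk_Nil_iff)
    with p have arc: "e \<in> parcs G" "fst e = v" "awalk (snd e) q r"
      by (auto simp: awalk_Cons_iff)
    have "h (snd e) \<le> length q"
      unfolding h_def using arc(3) by (intro Least_le) blast
    \<comment> \<open>The reverse inequality: \<open>e\<close> followed by a shortest walk from
      \<open>snd e\<close> is a walk from \<open>v\<close>.\<close>
    moreover have "\<exists>p. awalk (snd e) p r \<and> length p = h (snd e)"
      unfolding h_def by (rule LeastI_ex) (use arc(3) in blast)
    then obtain q' where q': "awalk (snd e) q' r" "length q' = h (snd e)" by blast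
    have "awalk v (e # q') r" using arc q' by (auto simp: awalk_Cons_iff)
    then have "h v \<le> length (e # q')" unfolding h_def by (intro Least_le) blast
    ultimately have "h v = Suc (h (snd e))" using p(2) q'(2) e by simp
    then show ?thesis using arc by (metis prod.collapse)
  qed
  then have "\<exists>parent. \<forall>v \<in> pverts G - {r}. (v, parent v) \<in> parcs G \<and> h v = Suc (h (parent v))"
    by metis
  then show ?thesis using that by blast
qed

text \<open>The arcs to parents and their reverses form a connected spanning subgraph
  \<open>H\<close>. Any further arc would close a cycle, so these are all the arcs: two for each
  vertex other than the root.\<close>

lemma card_parcs: "card (parcs G) = 2 * (card (pverts G) - 1)"
proof -
  obtain r where r: "r \<in> pverts G" using pverts_nonempty by blast
  obtain h :: "'a \<Rightarrow> nat" and parent where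
    par: "\<And>v. v \<in> pverts G - {r} \<Longrightarrow> (v, parent v) \<in> parcs G \<and> h v = Suc (h (parent v))"
    by (rule ex_parent_function[OF r]) blast
  define F where "F = (\<lambda>v. (v, parent v)) ` (pverts G - {r})"
  have F_sub: "F \<subseteq> parcs G" using par by (auto simp: F_def)
  have Fc_sub: "F\<inverse> \<subseteq> parcs G" using F_sub arcs_symmetric by auto
  define H where "H = \<lparr>pverts = pverts G, parcs = F \<union> F\<inverse>\<rparr>"
  have H_arcs: "parcs H = F \<union> F\<inverse>" and H_verts: "pverts H = pverts G"
    by (simp_all add: H_def)
  interpret H: pair_sym_digraph H
  proof unfold_locales
    show "symmetric (with_proj H)"
      by (auto simp: symmetric_def H_arcs sym_def)
  qed (use F_sub Fc_sub wellformed in \<open>auto simp: H_arcs H_verts in_arcsD1 in_arcsD2\<close>)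
  have to_root: "v \<rightarrow>\<^sup>*\<^bsub>with_proj H\<^esub> r" if "v \<in> pverts G" for v
    using that
  proof (induction "h v" arbitrary: v rule: less_induct)
    case less
    show ?case
    proof (cases "v = r")
      case True
      then show ?thesis using r by (auto simp: H_verts)
    next
      case False
      then have *: "(v, parent v) \<in> parcs G" "h v = Suc (h (parent v))"
        using par less.prems by auto
      then have "parent v \<rightarrow>\<^sup>*\<^bsub>with_proj H\<^esub> r"
        using less.hyps[of "parent v"] in_arcsD2 by auto
      moreover have "(v, parent v) \<in> parcs H"
        using False less.prems by (auto simp: H_arcs F_def)
      ultimately show ?thesis by (intro H.adj_reachable_trans[of v "parent v"]) auto
    qed
  qed
  \<comment> \<open>An arc outside \<open>F\<close> closes a cycle together with a path inside \<open>F\<close>.\<close>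
  have "parcs G \<subseteq> F \<union> F\<inverse>"
  proof (rule ccontr)
    assume "\<not> parcs G \<subseteq> F \<union> F\<inverse>"
    then obtain u v where uv: "(u, v) \<in> parcs G" "(u, v) \<notin> F \<union> F\<inverse>" by auto
    have "v \<rightarrow>\<^sup>*\<^bsub>with_proj H\<^esub> u"
      using to_root[of u] to_root[of v] uv in_arcsD1 in_arcsD2
      by (meson H.reachable_trans H.symmetric_reachable')
    then obtain p where p: "H.apath v p u" by (auto simp: H.reachable_apath)
    then have "set p \<subseteq> F \<union> F\<inverse>" "pcas v p u" "distinct (pawalk_verts v p)"
      by (auto simp: H.apath_def H.awalk_def H_arcs)
    then have walk: "awalk v p u"
      using uv F_sub Fc_sub in_arcsD2 by (auto simp: awalk_def)
    have "cycle ((u, v) # p)"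
      unfolding cycle_def
      using uv walk \<open>distinct (pawalk_verts v p)\<close> in_arcsD1
      by (intro exI[of _ u]) (auto simp: awalk_Cons_iff)
    then have "length p < 2" using acyc by fastforce
    \<comment> \<open>If \<open>p\<close> is empty, \<open>(u, v)\<close> is a loop; if
      \<open>p\<close> is a single arc, \<open>(u, v)\<close> is the reverse of an arc of
      \<open>H\<close>.\<close>
    then consider "p = []" | e where "p = [e]"
      by (cases p) (auto simp: less_Suc_eq)
    then show False
    proof cases
      case 1
      then show False using \<open>pcas v p u\<close> uv(1) no_loops' by auto
    next
      case 2
      then show False using \<open>pcas v p u\<close> \<open>set p \<subseteq> F \<union> F\<inverse>\<close> uv(2) by (cases e) auto
    qed
  qed
  then have "parcs G = F \<union> F\<inverse>" using F_sub Fc_sub by blast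
  moreover have "h (parent v) < h v" if "v \<in> pverts G - {r}" for v
    using par[OF that] by simp
  ultimately show ?thesis
    using card_symmetric_parent_arcs[OF _ _ F_def, of h] r by simp
qed

lemma degree_pos:
  assumes "2 \<le> card (pverts G)" "v \<in> pverts G"
  shows "0 < out_degree (with_proj G) v"
proof -
  have "\<not> pverts G \<subseteq> {v}"
    using assms(1) card_mono[of "{v}" "pverts G"] by auto
  then obtain w where "w \<in> pverts G" "w \<noteq> v" by blast
  then obtain x where "(v, x) \<in> parcs G"
    using reachable_all[OF assms(2), of w] converse_reachable_cases[of v w] by auto
  then have "out_arcs (with_proj G) v \<noteq> {}" by (auto simp: out_arcs_def)
  then show ?thesis unfolding out_degree_def by (simp add: card_gt_0_iff finite_out_arcs)
qed

text \<open>Two adjacent leaves have no neighbours but each other, so by connectedness they would be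
  the whole tree.\<close>

lemma leaves_not_adjacent:
  assumes n: "3 \<le> card (pverts G)" and uv: "(u, v) \<in> parcs G"
    and u: "out_degree (with_proj G) u = 1"
  shows "out_degree (with_proj G) v \<noteq> 1"
proof
  assume v: "out_degree (with_proj G) v = 1"
  have vu: "(v, u) \<in> parcs G" using uv arcs_symmetric by blast
  have "(u, v) \<in> out_arcs (with_proj G) u" "(v, u) \<in> out_arcs (with_proj G) v"
    using uv vu by auto
  then have out: "out_arcs (with_proj G) u = {(u, v)}" "out_arcs (with_proj G) v = {(v, u)}"
    using u v unfolding out_degree_def by (metis card_1_singletonE singletonD)+
  have closed: "y \<in> {u, v}" if "x \<in> {u, v}" "(x, y) \<in> parcs G" for x y
  proof -
    have "(x, y) \<in> out_arcs (with_proj G) x" using that by simp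
    then show ?thesis using that(1) out by auto
  qed
  have "w \<in> {u, v}" if "w \<in> pverts G" for w
  proof -
    have "u \<rightarrow>\<^sup>*\<^bsub>with_proj G\<^esub> w" using that uv in_arcsD1 reachable_all by blast
    then show ?thesis
    proof (induction rule: reachable_induct)
      case (step x y)
      then show ?case using closed[of x y] by simp
    qed simp
  qed
  then have "pverts G \<subseteq> {u, v}" by blast
  then have "card (pverts G) \<le> card {u, v}" by (intro card_mono) auto
  also have "\<dots> \<le> 2" by (simp add: card_insert_if)
  finally show False using n by simp
qed

end

section \<open>Bounding the index by the number of leaves\<close>

definition leaves :: "'a pair_pre_digraph \<Rightarrow> 'a set" where
  "leaves G = {v \<in> pverts G. out_degree (with_proj G) v = 1}"

definition at_most_one_branch_vertex :: "'a pair_pre_digraph \<Rightarrow> bool" where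
  "at_most_one_branch_vertex G \<longleftrightarrow>
    (\<forall>u \<in> pverts G. \<forall>v \<in> pverts G.
      3 \<le> out_degree (with_proj G) u \<longrightarrow> 3 \<le> out_degree (with_proj G) v \<longrightarrow> u = v)"

lemma (in pair_fin_digraph) sum_parcs_fst:
  fixes f :: "'a \<Rightarrow> real"
  shows "(\<Sum>e\<in>parcs G. f (fst e)) = (\<Sum>v\<in>pverts G. real (out_degree (with_proj G) v) * f v)"
proof -
  have "(\<Sum>e\<in>parcs G. f (fst e)) = (\<Sum>v\<in>pverts G. \<Sum>e | e \<in> parcs G \<and> fst e = v. f (fst e))"
    using pair_finite_arcs pair_finite_verts in_arcsD1 by (intro sum.group[symmetric]) auto
  also have "\<dots> = (\<Sum>v\<in>pverts G. real (out_degree (with_proj G) v) * f v)"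
    by (intro sum.cong) (auto simp: out_degree_def out_arcs_def)
  finally show ?thesis .
qed

lemma (in pair_sym_digraph) sum_parcs_snd:
  "(\<Sum>e\<in>parcs G. f (snd e)) = (\<Sum>e\<in>parcs G. f (fst e))"
  by (rule sum.reindex_bij_witness[where i=prod.swap and j=prod.swap])
    (auto simp: arcs_symmetric)

text \<open>The value of \<open>a\<^sup>3 - 4a\<close> at \<open>a = x + 2\<close>.\<close>

definition excess_cubic :: "nat \<Rightarrow> nat" where
  "excess_cubic x = x ^ 3 + 6 * x ^ 2 + 8 * x"

lemma excess_cubic_0 [simp]: "excess_cubic 0 = 0"
  by (simp add: excess_cubic_def)

text \<open>The cross term is nonnegative, which gives superadditivity, and it is positive when both
  \<open>x\<close> and \<open>y\<close> are, which gives the equality case.\<close>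

lemma excess_cubic_add:
  "excess_cubic (x + y) = excess_cubic x + excess_cubic y + x * y * (3 * x + 3 * y + 12)"
  by (simp add: excess_cubic_def algebra_simps power2_eq_square power3_eq_cube)

lemma sum_excess_cubic_le:
  assumes "finite S"
  shows "(\<Sum>i\<in>S. excess_cubic (f i)) \<le> excess_cubic (\<Sum>i\<in>S. f i)"
  using assms by induction (auto simp: excess_cubic_add)

lemma sum_excess_cubic_eq_iff:
  assumes "finite S"
  shows "(\<Sum>i\<in>S. excess_cubic (f i)) = excess_cubic (\<Sum>i\<in>S. f i) \<longleftrightarrow>
    (\<forall>i\<in>S. \<forall>j\<in>S. 0 < f i \<longrightarrow> 0 < f j \<longrightarrow> i = j)" (is "?L \<longleftrightarrow> ?R")
proof
  assume L: ?L
  show ?R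
  proof (rule ccontr)
    assume "\<not> ?R"
    then obtain i j where ij: "i \<in> S" "j \<in> S" "0 < f i" "0 < f j" "i \<noteq> j" by blast
    \<comment> \<open>From here on \<open>?R\<close> is the sum over all indices other than
      \<open>i\<close>, merged into one block. Merging loses nothing by superadditivity, and the
      cross term between \<open>f i\<close> and the block is strictly positive.\<close>
    let ?R = "\<Sum>k\<in>S - {i}. f k"
    have "f j \<le> ?R" using ij assms by (intro member_le_sum) auto
    with ij have R: "0 < ?R" by linarith
    have "(\<Sum>k\<in>S. excess_cubic (f k)) = excess_cubic (f i) + (\<Sum>k\<in>S - {i}. excess_cubic (f k))"
      using assms ij by (intro sum.remove) auto
    also have "\<dots> \<le> excess_cubic (f i) + excess_cubic ?R"
      using sum_excess_cubic_le[of "S - {i}" f] assms by simp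
    also have "\<dots> < excess_cubic (f i + ?R)"
      using ij R by (simp add: excess_cubic_add)
    also have "f i + ?R = (\<Sum>k\<in>S. f k)"
      using assms ij by (intro sum.remove[symmetric]) auto
    finally show False using L by simp
  qed
next
  assume R: ?R
  show ?L
  proof (cases "\<exists>i\<in>S. 0 < f i")
    case True
    then obtain i where i: "i \<in> S" "0 < f i" by blast
    with R have "f k = 0" if "k \<in> S - {i}" for k using that by blast
    with assms i show ?thesis by (simp add: sum.remove[of S i])
  qed simp
qed

text \<open>The shift by 4 makes degree 2 weigh nothing. The correction 6 lifts the value at 1 from
  -3 to 3, as an edge from a leaf to degree \<open>b\<close> contributes
  \<open>b^2 - 1 = (b^2 - 4) + 3\<close>.\<close>

definition degree_weight :: "nat \<Rightarrow> real" where
  "degree_weight a = real a ^ 2 - 4 + (if a = 1 then 6 else 0)"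

lemma degree_weight_1 [simp]: "degree_weight (Suc 0) = 3"
  by (simp add: degree_weight_def)

lemma four_le_square: "4 \<le> real a ^ 2" if "2 \<le> a"
  using power_mono[of 2 "real a" 2] that by simp

text \<open>For \<open>2 \<le> b \<le> a\<close> the slack is \<open>2 * b^2 - 8\<close>, which is
  nonnegative and vanishes at \<open>b = 2\<close>. A leaf against a degree of at least 2 has no
  slack, and two leaves give 0 against 6.\<close>

lemma abs_diff_squares_le:
  assumes "1 \<le> a" "1 \<le> b"
  shows "\<bar>real a ^ 2 - real b ^ 2\<bar> \<le> degree_weight a + degree_weight b"
proof -
  consider "a = 1" "b = 1" | "a = 1" "2 \<le> b" | "2 \<le> a" "b = 1" | "2 \<le> a" "2 \<le> b"
    using assms by linarith
  then show ?thesis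
    by cases (use four_le_square[of a] four_le_square[of b] in
      \<open>auto simp: degree_weight_def\<close>)
qed

lemma abs_diff_squares_eq:
  assumes "1 \<le> a" "1 \<le> b" "a \<le> 2 \<or> b \<le> 2" "a \<noteq> 1 \<or> b \<noteq> 1"
  shows "\<bar>real a ^ 2 - real b ^ 2\<bar> = degree_weight a + degree_weight b"
proof -
  consider "a = 1" "2 \<le> b" | "a = 2" "2 \<le> b" | "b = 1" "2 \<le> a" | "b = 2" "2 \<le> a"
    | "a = 2" "b = 1" | "a = 1" "b = 2"
    using assms by linarith
  then show ?thesis
    by cases (use four_le_square[of a] four_le_square[of b] in
      \<open>auto simp: degree_weight_def\<close>)
qed

text \<open>At \<open>a = x + 2\<close> the product \<open>a * (a^2 - 4)\<close> is the cubic in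
  \<open>x\<close>. At \<open>a = 1\<close> the truncated difference \<open>a - 2\<close> is 0, so
  only the constant 3 remains.\<close>

lemma degree_weight_excess:
  assumes "1 \<le> a"
  shows "real a * degree_weight a = (if a = 1 then 3 else 0) + real (excess_cubic (a - 2))"
proof (cases "a = 1")
  case False
  define x where "x = a - 2"
  then have "a = x + 2" using assms False by simp
  then show ?thesis
    by (simp add: degree_weight_def excess_cubic_def algebra_simps power2_eq_square power3_eq_cube)
qed simp

section \<open>Degree sums and the leaf bound in a tree\<close>

context undirected_tree_graph begin

lemma finite_leaves: "finite (leaves G)"
  by (simp add: leaves_def)

text \<open>The degrees sum to \<open>2n - 2\<close>, so the untruncated differences from 2 sum to
  -2. Truncation replaces the -1 of each leaf by 0 and thus adds one per leaf.\<close>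

lemma sum_degree_excess:
  assumes "2 \<le> card (pverts G)"
  shows "(\<Sum>v\<in>pverts G. out_degree (with_proj G) v - 2) + 2 = card (leaves G)"
proof -
  let ?d = "out_degree (with_proj G)"
  have "real (card (parcs G)) = (\<Sum>v\<in>pverts G. real (?d v))"
    using sum_parcs_fst[of "\<lambda>_. 1"] by simp
  then have "(\<Sum>v\<in>pverts G. real (?d v)) = 2 * real (card (pverts G)) - 2"
    using card_parcs assms by (simp add: of_nat_diff)
  moreover have "real (?d v - 2) = real (?d v) - 2 + (if ?d v = 1 then 1 else 0)"
    if "v \<in> pverts G" for v
    using degree_pos[OF assms that] by (auto simp: of_nat_diff)
  then have "(\<Sum>v\<in>pverts G. real (?d v - 2)) =
      (\<Sum>v\<in>pverts G. real (?d v) - 2 + (if ?d v = 1 then 1 else 0))"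
    by (intro sum.cong) auto
  moreover have "\<dots> = (\<Sum>v\<in>pverts G. real (?d v)) - 2 * real (card (pverts G)) + real (card (leaves G))"
    by (simp add: sum.distrib sum_subtractf leaves_def flip: sum.inter_filter)
  ultimately have "real ((\<Sum>v\<in>pverts G. ?d v - 2) + 2) = real (card (leaves G))"
    by simp
  then show ?thesis by (simp only: of_nat_eq_iff)
qed

lemma sum_degree_weight:
  assumes "2 \<le> card (pverts G)"
  shows "(\<Sum>v\<in>pverts G. real (out_degree (with_proj G) v) * degree_weight (out_degree (with_proj G) v))
    = 3 * real (card (leaves G)) + real (\<Sum>v\<in>pverts G. excess_cubic (out_degree (with_proj G) v - 2))"
proof -
  have "(\<Sum>v\<in>pverts G. real (out_degree (with_proj G) v) * degree_weight (out_degree (with_proj G) v))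
    = (\<Sum>v\<in>pverts G. (if out_degree (with_proj G) v = 1 then 3 else 0) +
        real (excess_cubic (out_degree (with_proj G) v - 2)))"
    using degree_pos[OF assms] by (intro sum.cong degree_weight_excess) (auto simp: Suc_le_eq)
  also have "\<dots> = 3 * real (card (leaves G)) +
      real (\<Sum>v\<in>pverts G. excess_cubic (out_degree (with_proj G) v - 2))"
    by (simp add: sum.distrib leaves_def flip: sum.inter_filter)
  finally show ?thesis .
qed

text \<open>With \<open>L\<close> leaves the total excess is \<open>L - 2\<close>, where the cubic
  takes the value \<open>L^3 - 4 * L\<close>; the 3 per leaf turns this into
  \<open>L^3 - L\<close>.\<close>

lemma excess_cubic_leaves:
  assumes "2 \<le> card (pverts G)"
  shows "3 * real (card (leaves G)) + real (excess_cubic (\<Sum>v\<in>pverts G. out_degree (with_proj G) v - 2))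
    = real (card (leaves G)) ^ 3 - real (card (leaves G))"
  unfolding sum_degree_excess[OF assms, symmetric]
  by (simp add: excess_cubic_def algebra_simps power2_eq_square power3_eq_cube)

text \<open>Two estimates are chained: the edgewise bound by weights, then superadditivity of the
  cubic. The second is tight exactly when there is at most one branch vertex, and this condition
  makes the first tight as well.\<close>

lemma
  assumes n: "3 \<le> card (pverts G)"
  shows SO1_le_leaves: "SO1 G \<le> 1 / 2 * (real (card (leaves G)) ^ 3 - real (card (leaves G)))"
    and SO1_eq_leaves_iff: "SO1 G = 1 / 2 * (real (card (leaves G)) ^ 3 - real (card (leaves G))) \<longleftrightarrow>
      at_most_one_branch_vertex G"
proof -
  let ?B = "1 / 2 * (real (card (leaves G)) ^ 3 - real (card (leaves G)))"
  let ?d = "out_degree (with_proj G)"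
  let ?w = "\<lambda>e. \<bar>real (?d (fst e)) ^ 2 - real (?d (snd e)) ^ 2\<bar>"
  let ?W = "\<lambda>e. degree_weight (?d (fst e)) + degree_weight (?d (snd e))"
  define L where "L = real (card (leaves G))"
  define c where "c = (\<Sum>v\<in>pverts G. excess_cubic (?d v - 2))"
  define c' where "c' = excess_cubic (\<Sum>v\<in>pverts G. ?d v - 2)"
  define w where "w = (\<Sum>e\<in>parcs G. ?w e)"
  have n2: "2 \<le> card (pverts G)" using n by simp
  have pos: "1 \<le> ?d (fst e)" "1 \<le> ?d (snd e)" if "e \<in> parcs G" for e
    using that degree_pos[OF n2] arc_fst_in_verts arc_snd_in_verts by (auto simp: Suc_le_eq)
  \<comment> \<open>One factor 1/2 comes from the index, the other from counting each edge as two
    arcs.\<close>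
  have SO1: "SO1 G = w / 4"
    by (simp add: SO1_def w_def case_prod_beta)
  \<comment> \<open>A vertex is the tail of as many arcs as its degree and the head of equally many,
    hence the factor 2.\<close>
  have W: "(\<Sum>e\<in>parcs G. ?W e) = 2 * (3 * L + real c)"
    using sum_parcs_fst[of "\<lambda>v. degree_weight (?d v)"] sum_parcs_snd[of "\<lambda>v. degree_weight (?d v)"]
    by (simp add: sum.distrib sum_degree_weight[OF n2] L_def c_def)
  have wW: "w \<le> 2 * (3 * L + real c)"
    unfolding w_def W[symmetric] using pos by (intro sum_mono abs_diff_squares_le) auto
  have "c \<le> c'" unfolding c_def c'_def by (rule sum_excess_cubic_le) simp
  then have C: "real c \<le> real c'" by simp
  have B: "?B = 1 / 2 * (3 * L + real c')"
    unfolding excess_cubic_leaves[OF n2, symmetric] L_def c'_def by simp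
  show "SO1 G \<le> ?B" unfolding SO1 B using wW C by argo
  have C_iff: "c = c' \<longleftrightarrow> at_most_one_branch_vertex G"
    unfolding at_most_one_branch_vertex_def c_def c'_def
    by (subst sum_excess_cubic_eq_iff) (auto simp: Suc_le_eq numeral_3_eq_3 numeral_2_eq_2)
  show "SO1 G = ?B \<longleftrightarrow> at_most_one_branch_vertex G"
  proof
    assume "SO1 G = ?B"
    then have "real c = real c'"
      unfolding SO1 B using wW C by argo
    then show "at_most_one_branch_vertex G" unfolding of_nat_eq_iff C_iff .
  next
    assume one: "at_most_one_branch_vertex G"
    \<comment> \<open>No edge joins two branch vertices, since it would be a loop, and no edge joins
      two leaves; so every edge is tight.\<close>
    have "?w e = ?W e" if e: "e \<in> parcs G" for e
    proof (rule abs_diff_squares_eq)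
      show "?d (fst e) \<le> 2 \<or> ?d (snd e) \<le> 2"
      proof (rule ccontr)
        assume "\<not> ?thesis"
        then have "3 \<le> ?d (fst e)" "3 \<le> ?d (snd e)" by auto
        then show False
          using one no_loops[OF e] arc_fst_in_verts[OF e] arc_snd_in_verts[OF e]
          unfolding at_most_one_branch_vertex_def by blast
      qed
      show "?d (fst e) \<noteq> 1 \<or> ?d (snd e) \<noteq> 1"
        using leaves_not_adjacent[OF n, of "fst e" "snd e"] e by auto
    qed (use pos e in auto)
    then have "w = (\<Sum>e\<in>parcs G. ?W e)" unfolding w_def by (intro sum.cong) auto
    then show "SO1 G = ?B" unfolding SO1 B W using one C_iff by simp
  qed
qed

end

section \<open>Diametral paths\<close>

definition path_in :: "'a pair_pre_digraph \<Rightarrow> nat \<Rightarrow> (nat \<Rightarrow> 'a) \<Rightarrow> bool" where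
  "path_in G d p \<longleftrightarrow> inj_on p {..d} \<and> p ` {..d} \<subseteq> pverts G \<and> (\<forall>j<d. (p j, p (Suc j)) \<in> parcs G)"

lemma length_pawalk_verts: "length (pawalk_verts u q) = Suc (length q)"
  by (induction q arbitrary: u) auto

lemma (in pair_wf_digraph) awalk_consecutive_verts:
  assumes "awalk u q v" "j < length q"
  shows "(pawalk_verts u q ! j, pawalk_verts u q ! Suc j) \<in> parcs G"
  using assms
proof (induction q arbitrary: u j)
  case (Cons e q)
  have e: "e \<in> parcs G" "fst e = u" "awalk (snd e) q v"
    using Cons.prems(1) by (auto simp: awalk_Cons_iff)
  show ?case
  proof (cases j)
    case 0
    have "pawalk_verts (snd e) q ! 0 = snd e" using e(3) by (cases q) (auto simp: awalk_Cons_iff)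
    then show ?thesis using e 0 by auto
  next
    case (Suc k)
    then show ?thesis using Cons.IH[OF e(3), of k] Cons.prems(2) by simp
  qed
qed simp

lemma (in pair_wf_digraph) apath_imp_path_in:
  assumes "apath u q v"
  shows "path_in G (length q) (\<lambda>j. pawalk_verts u q ! j)"
proof -
  have q: "awalk u q v" "distinct (pawalk_verts u q)" using assms by (auto simp: apath_def)
  have "set (pawalk_verts u q) \<subseteq> pverts G" using q(1) by auto
  then show ?thesis
    unfolding path_in_def using q awalk_consecutive_verts[OF q(1)]
    by (auto simp: inj_on_nth length_pawalk_verts less_Suc_eq_le subset_iff)
qed

text \<open>Turns the diameter, a supremum in \<open>ereal\<close>, into the distance between two
  actual vertices.\<close>

lemma SUP_attained:
  fixes f :: "'a \<Rightarrow> 'b :: complete_linorder"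
  assumes "finite A" "A \<noteq> {}"
  shows "\<exists>x\<in>A. (SUP x\<in>A. f x) = f x"
  using Max_in[of "f ` A"] assms by (auto simp: Max_Sup)

text \<open>Reversal moves position \<open>i\<close> to \<open>d - i\<close>, which brings the
  attachment vertex into the first half of the path.\<close>

lemma path_in_rev:
  assumes "path_in G d p" "pair_sym_digraph G"
  shows "path_in G d (\<lambda>j. p (d - j))"
proof -
  interpret pair_sym_digraph G by fact
  have "(p (d - j), p (d - Suc j)) \<in> parcs G" if "j < d" for j
  proof -
    have "(p (d - Suc j), p (Suc (d - Suc j))) \<in> parcs G"
      using assms(1) that by (simp add: path_in_def)
    moreover have "Suc (d - Suc j) = d - j" using that by simp
    ultimately show ?thesis using arcs_symmetric by simp
  qed
  moreover have "inj_on (\<lambda>j. p (d - j)) {..d}"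
    using assms(1) unfolding path_in_def inj_on_def by (metis atMost_iff diff_diff_cancel diff_le_self)
  ultimately show ?thesis using assms(1) by (auto simp: path_in_def)
qed

text \<open>Two vertices realise the diameter, and with unit costs a cheapest path between them has
  exactly \<open>d\<close> arcs.\<close>

lemma (in undirected_tree_graph) ex_path_of_diameter:
  assumes "diameter_graph G = ereal (real d)"
  obtains p where "path_in G d p"
proof -
  obtain u where u: "u \<in> pverts G" "(SUP v\<in>pverts G. dist_graph G u v) = ereal (real d)"
    using SUP_attained[OF _ pverts_nonempty, of "\<lambda>u. SUP v\<in>pverts G. dist_graph G u v"] assms
    by (auto simp: diameter_graph_def)
  obtain v where v: "v \<in> pverts G" "dist_graph G u v = ereal (real d)"
    using SUP_attained[OF _ pverts_nonempty, of "dist_graph G u"] u by auto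
  obtain q where q: "apath u q v" "ereal (awalk_cost (\<lambda>_. 1) q) = ereal (real d)"
    using min_cost_awalk[OF reachable_all[OF u(1) v(1)], of "\<lambda>_. 1"] v(2)
    by (auto simp: dist_graph_def)
  have "length q = d" using q(2) by (simp add: awalk_cost_def sum_list_triv)
  then show ?thesis using that apath_imp_path_in[OF q(1)] by auto
qed

lemma (in pair_fin_digraph) card_le_out_degree:
  assumes "\<And>w. w \<in> S \<Longrightarrow> (v, w) \<in> parcs G"
  shows "card S \<le> out_degree (with_proj G) v"
proof -
  have "card S = card (Pair v ` S)" by (simp add: card_image inj_on_def)
  also have "\<dots> \<le> out_degree (with_proj G) v"
    unfolding out_degree_def using assms by (intro card_mono finite_out_arcs) auto
  finally show ?thesis .
qed

lemma out_degree_le_card: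
  assumes "finite S" "\<And>w. (v, w) \<in> parcs G \<Longrightarrow> w \<in> S"
  shows "out_degree (with_proj G) v \<le> card S"
proof -
  have "out_degree (with_proj G) v \<le> card (Pair v ` S)"
    unfolding out_degree_def using assms by (intro card_mono) (auto simp: out_arcs_def)
  also have "\<dots> = card S" by (simp add: card_image inj_on_def)
  finally show ?thesis .
qed

lemma (in pair_graph) path_interior_neighbours:
  assumes "path_in G d p" "j \<in> {1..<d}"
  shows "(p j, p (j - 1)) \<in> parcs G" "(p j, p (Suc j)) \<in> parcs G" "p (j - 1) \<noteq> p (Suc j)"
proof -
  obtain k where "j = Suc k" "k < d" using assms(2) by (cases j) auto
  then show "(p j, p (j - 1)) \<in> parcs G"
    using assms(1) arcs_symmetric by (simp add: path_in_def)
  show "(p j, p (Suc j)) \<in> parcs G" using assms by (auto simp: path_in_def)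
  have "inj_on p {..d}" using assms(1) by (simp add: path_in_def)
  then show "p (j - 1) \<noteq> p (Suc j)" using assms(2) by (auto dest: inj_onD)
qed

lemma (in pair_graph) path_interior_not_leaves:
  assumes "path_in G d p"
  shows "p ` {1..<d} \<inter> leaves G = {}"
proof -
  have "2 \<le> out_degree (with_proj G) (p j)" if j: "j \<in> {1..<d}" for j
  proof -
    note * = path_interior_neighbours[OF assms j]
    have "2 = card {p (j - 1), p (Suc j)}" using *(3) by simp
    also have "\<dots> \<le> out_degree (with_proj G) (p j)"
      by (rule card_le_out_degree) (use * in blast)
    finally show ?thesis .
  qed
  then show ?thesis by (force simp: leaves_def)
qed

lemma card_path_interior:
  assumes "path_in G d p"
  shows "card (p ` {1..<d}) = d - 1"
  using assms by (subst card_image) (auto simp: path_in_def intro: inj_on_subset)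

lemma (in pair_graph) card_leaves_le:
  assumes "path_in G d p"
  shows "card (leaves G) + (d - 1) \<le> card (pverts G)"
proof -
  have "card (leaves G) + card (p ` {1..<d}) = card (leaves G \<union> p ` {1..<d})"
    using path_interior_not_leaves[OF assms]
    by (intro card_Un_disjoint[symmetric]) (auto simp: leaves_def)
  also have "\<dots> \<le> card (pverts G)"
    using assms by (intro card_mono) (auto simp: leaves_def path_in_def)
  finally show ?thesis using card_path_interior[OF assms] by simp
qed

section \<open>The extremal trees\<close>

text \<open>Replaces the offset \<open>k\<close> of a pendent vertex by a range for its number, so
  that the vertex set is an initial segment and adjacency is plain arithmetic.\<close>

lemma ex_pendent_index_iff:
  fixes n d x :: nat
  assumes "d < n"
  shows "(\<exists>k. x = d + k \<and> 1 \<le> k \<and> k \<le> n - d - 1) \<longleftrightarrow> d < x \<and> x < n"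
proof
  assume "d < x \<and> x < n"
  then show "\<exists>k. x = d + k \<and> 1 \<le> k \<and> k \<le> n - d - 1" by (intro exI[of _ "x - d"]) auto
qed (use assms in auto)

lemma pverts_path_with_pendents:
  assumes "d < n"
  shows "pverts (path_with_pendents n d i) = {..<n}"
proof -
  have "pverts (path_with_pendents n d i) = {0..d} \<union> {x. \<exists>k. x = d + k \<and> 1 \<le> k \<and> k \<le> n - d - 1}"
    by (simp add: path_with_pendents_def Let_def)
  also have "\<dots> = {..<n}" unfolding ex_pendent_index_iff[OF assms] using assms by force
  finally show ?thesis .
qed

lemma parcs_path_with_pendents:
  assumes "d < n"
  shows "(a, b) \<in> parcs (path_with_pendents n d i) \<longleftrightarrow>
    (a < d \<and> b = Suc a) \<or> (b < d \<and> a = Suc b) \<or> (a = i \<and> d < b \<and> b < n) \<or> (b = i \<and> d < a \<and> a < n)"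
proof -
  have "(a, b) \<in> parcs (path_with_pendents n d i) \<longleftrightarrow>
    (a < d \<and> b = Suc a) \<or> (b < d \<and> a = Suc b) \<or>
    (a = i \<and> (\<exists>k. b = d + k \<and> 1 \<le> k \<and> k \<le> n - d - 1)) \<or>
    (b = i \<and> (\<exists>k. a = d + k \<and> 1 \<le> k \<and> k \<le> n - d - 1))"
    by (auto simp: path_with_pendents_def Let_def)
  then show ?thesis unfolding ex_pendent_index_iff[OF assms] .
qed

text \<open>Rooted at 0, a path vertex \<open>j\<close> has parent \<open>j - 1\<close> and a
  pendent vertex has parent \<open>i\<close>. Parents have smaller numbers because
  \<open>i \<le> d\<close>, so the identity serves as height.\<close>

lemma card_parcs_path_with_pendents:
  assumes "i \<le> d" "d < n"
  shows "card (parcs (path_with_pendents n d i)) = 2 * (n - 1)"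
proof -
  define F where "F = (\<lambda>j. (j, if j \<le> d then j - 1 else i)) ` {1..<n}"
  have "parcs (path_with_pendents n d i) = F \<union> F\<inverse>"
    using assms by (auto simp: parcs_path_with_pendents F_def image_iff split: if_splits)
  then show ?thesis
    using card_symmetric_parent_arcs[OF _ _ F_def, of id] assms by auto
qed

lemma pair_wf_digraph_path_with_pendents:
  "i \<le> d \<Longrightarrow> d < n \<Longrightarrow> pair_wf_digraph (path_with_pendents n d i)"
  by unfold_locales (auto simp: pverts_path_with_pendents parcs_path_with_pendents)

lemma digraph_iso_with_projI:
  assumes "pair_wf_digraph G" "inj_on g (pverts G)"
    and "pverts H = g ` pverts G" "parcs H = map_prod g g ` parcs G"
  shows "digraph_iso (with_proj G) (with_proj H)"
proof -
  interpret pair_wf_digraph G by fact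
  let ?f = "\<lparr>iso_verts = g, iso_arcs = map_prod g g, iso_head = snd, iso_tail = fst\<rparr>"
  have "inj_on (map_prod g g) (parcs G)"
    using map_prod_inj_on[OF assms(2,2)] by (rule inj_on_subset) (auto intro: in_arcsD1 in_arcsD2)
  then have "digraph_isomorphism ?f"
    using assms(2) by (auto simp: digraph_isomorphism_def wf_digraph)
  moreover have "with_proj H = app_iso ?f (with_proj G)"
    using assms by (simp add: with_proj_def app_iso_def)
  ultimately show ?thesis unfolding digraph_iso_def by blast
qed

section \<open>Equality cases and isomorphism\<close>

context undirected_tree_graph begin

text \<open>The path is laid along \<open>p\<close> and the other vertices are numbered arbitrarily.
  This map sends arcs to arcs; that \<open>G\<close> has no further arcs follows by
  counting.\<close>

lemma digraph_iso_path_with_pendentsI: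
  assumes p: "path_in G d p" and i: "i \<le> d"
    and pendent: "\<And>w. w \<in> pverts G - p ` {..d} \<Longrightarrow> (p i, w) \<in> parcs G"
  shows "digraph_iso (with_proj G) (with_proj (path_with_pendents (card (pverts G)) d i))"
proof -
  let ?n = "card (pverts G)"
  let ?H = "path_with_pendents ?n d i"
  let ?W = "pverts G - p ` {..d}"
  have inj: "inj_on p {..d}" and sub: "p ` {..d} \<subseteq> pverts G"
    and arc: "\<And>j. j < d \<Longrightarrow> (p j, p (Suc j)) \<in> parcs G"
    using p by (auto simp: path_in_def)
  have card_path: "card (p ` {..d}) = Suc d" using inj by (simp add: card_image)
  have n: "d < ?n" using card_mono[OF pair_finite_verts sub] card_path by simp
  have card_W: "card ?W = ?n - Suc d" using card_Diff_subset[OF _ sub] card_path by simp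
  \<comment> \<open>The enumeration starts at 1 because the first pendent vertex is
    \<open>d + 1\<close>.\<close>
  obtain e where e: "bij_betw e {1..card ?W} ?W"
    using ex_bij_betw_nat_finite_1[of ?W] by auto
  define g where "g j = (if j \<le> d then p j else e (j - d))" for j
  have "bij_betw g {..d} (p ` {..d})"
    using inj by (auto simp: bij_betw_def g_def inj_on_def)
  moreover have "bij_betw g {d<..<?n} ?W"
  proof -
    have "bij_betw (\<lambda>j. j - d) {d<..<?n} {1..card ?W}"
      by (rule bij_betw_byWitness[where f'="\<lambda>k. k + d"]) (use n in \<open>auto simp: card_W\<close>)
    then have "bij_betw (e \<circ> (\<lambda>j. j - d)) {d<..<?n} ?W" using e by (rule bij_betw_trans)
    then show ?thesis by (rule bij_betw_cong[THEN iffD1, rotated]) (auto simp: g_def)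
  qed
  ultimately have "bij_betw g ({..d} \<union> {d<..<?n}) (p ` {..d} \<union> ?W)"
    by (rule bij_betw_combine) auto
  moreover have "{..d} \<union> {d<..<?n} = pverts ?H" using n by (auto simp: pverts_path_with_pendents)
  moreover have "p ` {..d} \<union> ?W = pverts G" using sub by blast
  ultimately have g: "bij_betw g (pverts ?H) (pverts G)" by simp
  have gW: "g j \<in> ?W" if "d < j" "j < ?n" for j
    using \<open>bij_betw g {d<..<?n} ?W\<close> that by (auto dest!: bij_betwE)
  interpret H: pair_wf_digraph ?H using i n by (rule pair_wf_digraph_path_with_pendents)
  have "map_prod g g ` parcs ?H \<subseteq> parcs G"
  proof
    fix x assume "x \<in> map_prod g g ` parcs ?H"
    then obtain a b where x: "x = (g a, g b)" and ab: "(a, b) \<in> parcs ?H" by auto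
    from ab consider "a < d" "b = Suc a" | "b < d" "a = Suc b"
      | "a = i" "d < b" "b < ?n" | "b = i" "d < a" "a < ?n"
      unfolding parcs_path_with_pendents[OF n] by blast
    then show "x \<in> parcs G"
    proof cases
      case 1
      then show ?thesis using arc by (simp add: x g_def)
    next
      case 2
      then show ?thesis using arc arcs_symmetric by (simp add: x g_def)
    next
      case 3
      then show ?thesis using pendent[OF gW[of b]] i by (simp add: x g_def)
    next
      case 4
      then show ?thesis using arcs_symmetric[OF pendent[OF gW[of a]]] i by (simp add: x g_def)
    qed
  qed
  moreover have "card (map_prod g g ` parcs ?H) = card (parcs ?H)"
  proof (rule card_image)
    have "inj_on g (pverts ?H)" using g by (rule bij_betw_imp_inj_on)
    from map_prod_inj_on[OF this this] show "inj_on (map_prod g g) (parcs ?H)"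
      by (rule inj_on_subset) (auto intro: H.in_arcsD1 H.in_arcsD2)
  qed
  \<comment> \<open>Both graphs have \<open>2(n - 1)\<close> arcs, so the inclusion is an equality.\<close>
  ultimately have "map_prod g g ` parcs ?H = parcs G"
    using card_parcs card_parcs_path_with_pendents[OF i n]
    by (intro card_seteq pair_finite_arcs) auto
  then have "digraph_iso (with_proj ?H) (with_proj G)"
    using g H.pair_wf_digraph_axioms
    by (intro digraph_iso_with_projI[of _ g]) (auto simp: bij_betw_def)
  then show ?thesis using H.wf_digraph by (rule digraph_iso_swap[rotated])
qed

text \<open>By \<open>L\<close>, leaves and interior path vertices exhaust the tree. A vertex off
  the path is therefore a leaf, and its neighbour, not being a leaf, is interior. With its two path
  neighbours that neighbour is a branch vertex, hence the same one every time.\<close>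

lemma common_attachment_vertex:
  assumes d: "2 \<le> d" and p: "path_in G d p" and one: "at_most_one_branch_vertex G"
    and L: "card (leaves G) + (d - 1) = card (pverts G)"
  obtains i where "i \<in> {1..<d}" "\<And>w. w \<in> pverts G - p ` {..d} \<Longrightarrow> (p i, w) \<in> parcs G"
proof -
  let ?W = "pverts G - p ` {..d}"
  have inj: "inj_on p {..d}" and sub: "p ` {..d} \<subseteq> pverts G"
    using p by (auto simp: path_in_def)
  have n: "3 \<le> card (pverts G)"
    using card_mono[OF pair_finite_verts sub] d inj by (simp add: card_image)
  have "leaves G \<union> p ` {1..<d} = pverts G"
  proof (rule card_subset_eq)
    have "card (leaves G \<union> p ` {1..<d}) = card (leaves G) + card (p ` {1..<d})"
      using path_interior_not_leaves[OF p] by (intro card_Un_disjoint) (auto simp: leaves_def)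
    then show "card (leaves G \<union> p ` {1..<d}) = card (pverts G)"
      using card_path_interior[OF p] L by simp
  qed (use sub in \<open>auto simp: leaves_def\<close>)
  then have interior: "v \<in> p ` {1..<d}" if "v \<in> pverts G" "v \<notin> leaves G" for v
    using that by blast
  have attached: "\<exists>j\<in>{1..<d}. (p j, w) \<in> parcs G \<and> 3 \<le> out_degree (with_proj G) (p j)" if w: "w \<in> ?W" for w
  proof -
    have "w \<in> leaves G" using interior[of w] w by (auto simp: image_iff)
    then have deg_w: "out_degree (with_proj G) w = 1" by (simp add: leaves_def)
    then obtain x where x: "(w, x) \<in> parcs G"
      unfolding out_degree_def by (metis card_1_singletonE in_out_arcs_conv insertI1 prod.collapse with_proj_simps(2,4))
    then have "x \<notin> leaves G" using leaves_not_adjacent[OF n x deg_w] by (simp add: leaves_def)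
    then obtain j where j: "j \<in> {1..<d}" "x = p j" using interior x in_arcsD2 by blast
    have "{p (j - 1), p (Suc j)} \<subseteq> p ` {..d}" using j by auto
    then have "w \<notin> {p (j - 1), p (Suc j)}" using w by blast
    then have "card {p (j - 1), p (Suc j), w} = 3"
      using path_interior_neighbours(3)[OF p j(1)] by auto
    moreover have "card {p (j - 1), p (Suc j), w} \<le> out_degree (with_proj G) (p j)"
      using path_interior_neighbours[OF p j(1)] arcs_symmetric[OF x] j
      by (intro card_le_out_degree) auto
    ultimately show ?thesis using j arcs_symmetric[OF x] by auto
  qed
  show ?thesis
  proof (cases "?W = {}")
    \<comment> \<open>The tree is the path itself, so any interior position will do.\<close>
    case True
    then show ?thesis using that[of 1] d by auto
  next
    case False
    then obtain w0 where "w0 \<in> ?W" by blast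
    with attached obtain i where i: "i \<in> {1..<d}" "3 \<le> out_degree (with_proj G) (p i)" by blast
    have "(p i, w) \<in> parcs G" if w: "w \<in> ?W" for w
    proof -
      obtain j where j: "j \<in> {1..<d}" "(p j, w) \<in> parcs G" "3 \<le> out_degree (with_proj G) (p j)"
        using attached[OF w] by blast
      have "p i \<in> pverts G" "p j \<in> pverts G" using sub i j by auto
      then have "p j = p i" using one i j unfolding at_most_one_branch_vertex_def by blast
      then show ?thesis using j by simp
    qed
    then show ?thesis using that i by blast
  qed
qed

lemma extremal_imp_iso:
  assumes d: "2 \<le> d" and p: "path_in G d p" and one: "at_most_one_branch_vertex G"
    and L: "card (leaves G) + (d - 1) = card (pverts G)"
  shows "\<exists>i\<in>{1..d div 2}. digraph_iso (with_proj G) (with_proj (path_with_pendents (card (pverts G)) d i))"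
proof -
  obtain i where i: "i \<in> {1..<d}" and att: "\<And>w. w \<in> pverts G - p ` {..d} \<Longrightarrow> (p i, w) \<in> parcs G"
    using common_attachment_vertex[OF assms] by blast
  show ?thesis
  proof (cases "i \<le> d div 2")
    case True
    then show ?thesis using digraph_iso_path_with_pendentsI[OF p _ att] i by auto
  next
    case False
    \<comment> \<open>Beyond the middle, the path is read backwards and \<open>d - i\<close> takes
      the place of \<open>i\<close>.\<close>
    have "path_in G d (\<lambda>j. p (d - j))" using p by (rule path_in_rev) unfold_locales
    moreover have "p (d - (d - i)) = p i" using i by simp
    moreover have "(\<lambda>j. p (d - j)) ` {..d} = p ` {..d}"
    proof -
      have "j \<in> (\<lambda>j. d - j) ` {..d}" if "j \<le> d" for j
        using that by (intro image_eqI[of _ _ "d - j"]) auto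
      then have "(\<lambda>j. d - j) ` {..d} = {..d}" by auto
      then show ?thesis by (metis image_image)
    qed
    ultimately have "digraph_iso (with_proj G) (with_proj (path_with_pendents (card (pverts G)) d (d - i)))"
      using att by (intro digraph_iso_path_with_pendentsI[where p="\<lambda>j. p (d - j)"]) auto
    moreover have "d - i \<in> {1..d div 2}" using False i by auto
    ultimately show ?thesis by blast
  qed
qed

text \<open>The isomorphism transports degrees. In the standard tree only \<open>i\<close> can have
  degree above 2, while the two path ends and the pendent vertices have degree at most 1. Positivity
  of degrees in \<open>G\<close> makes them leaves.\<close>

lemma iso_imp_extremal:
  assumes i: "1 \<le> i" "i < d" and n: "d < n"
    and iso: "digraph_iso (with_proj G) (with_proj (path_with_pendents n d i))"
  shows "at_most_one_branch_vertex G" "n \<le> card (leaves G) + (d - 1)"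
proof -
  let ?H = "path_with_pendents n d i"
  obtain f where f: "digraph_isomorphism f" "with_proj ?H = app_iso f (with_proj G)"
    using iso unfolding digraph_iso_def by blast
  define g where "g = iso_verts f"
  have inj: "inj_on g (pverts G)" using digraph_isomorphism_inj_on_verts[OF f(1)] by (simp add: g_def)
  have "verts (with_proj ?H) = g ` pverts G" unfolding f(2) g_def by simp
  then have img: "g ` pverts G = {..<n}" using pverts_path_with_pendents[OF n] by simp
  have deg: "out_degree (with_proj G) v = out_degree (with_proj ?H) (g v)" if "v \<in> pverts G" for v
    using out_degree_app_iso_eq[OF f(1), of v] that unfolding f(2) g_def by simp
  have deg2: "out_degree (with_proj ?H) j \<le> 2" if "j \<noteq> i" for j
  proof (cases "j \<le> d")
    case True
    have "out_degree (with_proj ?H) j \<le> card {j - 1, Suc j}"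
      using that i n True by (intro out_degree_le_card) (auto simp: parcs_path_with_pendents)
    also have "\<dots> \<le> 2" by (simp add: card_insert_if)
    finally show ?thesis .
  next
    case False
    have "out_degree (with_proj ?H) j \<le> card {i}"
      using that i n False by (intro out_degree_le_card) (auto simp: parcs_path_with_pendents)
    then show ?thesis by simp
  qed
  show "at_most_one_branch_vertex G"
    unfolding at_most_one_branch_vertex_def
  proof (intro ballI impI)
    fix u v assume uv: "u \<in> pverts G" "v \<in> pverts G"
      "3 \<le> out_degree (with_proj G) u" "3 \<le> out_degree (with_proj G) v"
    then have "g u = i" "g v = i" using deg deg2[of "g u"] deg2[of "g v"] by force+
    then show "u = v" using inj uv by (auto dest: inj_onD)
  qed
  have "card (g ` pverts G) = card (pverts G)" using inj by (rule card_image)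
  then have n_eq: "card (pverts G) = n" using img by simp
  have deg1: "out_degree (with_proj ?H) j \<le> 1" if "j \<in> insert 0 {d..<n}" for j
  proof -
    \<comment> \<open>The only possible neighbour of \<open>j\<close>; \<open>1 \<le> i\<close> and
      \<open>i < d\<close> keep both path ends free of pendent edges.\<close>
    define x where "x = (if j = 0 then 1 else if j = d then d - 1 else i)"
    have "out_degree (with_proj ?H) j \<le> card {x}"
      using that i n by (intro out_degree_le_card) (auto simp: parcs_path_with_pendents x_def)
    then show ?thesis by simp
  qed
  \<comment> \<open>This set has \<open>n - d + 1\<close> elements: the end 0, the end
    \<open>d\<close> and the \<open>n - d - 1\<close> pendent vertices.\<close>
  have "insert 0 {d..<n} \<subseteq> g ` leaves G"
  proof
    fix j assume j: "j \<in> insert 0 {d..<n}"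
    then have "j \<in> g ` pverts G" unfolding img using n by auto
    then obtain v where v: "v \<in> pverts G" "j = g v" by blast
    have "0 < out_degree (with_proj G) v" using degree_pos[OF _ v(1)] n_eq i n by simp
    then have "v \<in> leaves G" using deg1[OF j] deg[OF v(1)] v by (simp add: leaves_def)
    then show "j \<in> g ` leaves G" using v by blast
  qed
  then have "card (insert 0 {d..<n}) \<le> card (leaves G)"
    using surj_card_le[OF finite_leaves] by blast
  then show "n \<le> card (leaves G) + (d - 1)" using i n by simp
qed

end

lemma undirected_tree_graphI:
  assumes "undirected_tree T"
  shows "undirected_tree_graph T"
proof -
  interpret pair_graph T using assms by (simp add: undirected_tree_def)
  show ?thesis
    using assms by unfold_locales (auto simp: undirected_tree_def not_le)
qed

section \<open>Combining the leaf bound with the path bound\<close>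

theorem theorem3p1:
  fixes T :: "'a pair_pre_digraph" and n d :: nat
  assumes "2 \<le> d" and "d \<le> n - 1"
    and "undirected_tree T"
    and "card (pverts T) = n"
    and "diameter_graph T = ereal (real d)"
  shows "SO1 T \<le> 1 / 2 * (real n - real d + 1) * ((real n - real d + 1) ^ 2 - 1) \<and>
    (SO1 T = 1 / 2 * (real n - real d + 1) * ((real n - real d + 1) ^ 2 - 1) \<longleftrightarrow>
      (\<exists>i\<in>{1..d div 2}. digraph_iso (with_proj T) (with_proj (path_with_pendents n d i))))"
proof -
  interpret undirected_tree_graph T using assms(3) by (rule undirected_tree_graphI)
  obtain p where p: "path_in T d p" using ex_path_of_diameter[OF assms(5)] by blast
  have dn: "d < n" and n3: "3 \<le> card (pverts T)" using assms by auto
  define L D where "L = card (leaves T)" and "D = n - d + 1"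
  let ?cub = "\<lambda>x. real x ^ 3 - real x"
  have "real n - real d + 1 = real D" using dn by (simp add: D_def of_nat_diff)
  then have bound: "1 / 2 * (real n - real d + 1) * ((real n - real d + 1) ^ 2 - 1) = 1 / 2 * ?cub D"
    by (simp add: algebra_simps power2_eq_square power3_eq_cube)
  have LD: "L \<le> D" using card_leaves_le[OF p] assms(1,4) dn by (simp add: L_def D_def)
  \<comment> \<open>The difference of the cubics factors as \<open>D - L\<close> times
    \<open>D^2 + D * L + L^2 - 1\<close>, and \<open>d < n\<close> gives \<open>D\<close> at least
    2.\<close>
  have cub: "?cub L < ?cub D" if "L < D"
  proof -
    have "4 \<le> real D ^ 2" using dn by (intro four_le_square) (simp add: D_def)
    moreover have "0 \<le> real D * real L + real L ^ 2" by simp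
    ultimately have "0 < real D ^ 2 + (real D * real L + real L ^ 2) - 1" by linarith
    then have "0 < (real D - real L) * (real D ^ 2 + (real D * real L + real L ^ 2) - 1)"
      using that by (intro mult_pos_pos) auto
    also have "\<dots> = ?cub D - ?cub L"
      by (simp add: algebra_simps power2_eq_square power3_eq_cube)
    finally show ?thesis by simp
  qed
  have le: "SO1 T \<le> 1 / 2 * ?cub L" and eq: "SO1 T = 1 / 2 * ?cub L \<longleftrightarrow> at_most_one_branch_vertex T"
    using SO1_le_leaves[OF n3] SO1_eq_leaves_iff[OF n3] by (simp_all add: L_def)
  \<comment> \<open>If \<open>L < D\<close>, the leaf bound already lies strictly below the claimed
    one, so equality forces \<open>L = D\<close>.\<close>
  have "SO1 T = 1 / 2 * ?cub D \<longleftrightarrow> L = D \<and> at_most_one_branch_vertex T"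
    using le eq LD cub by (cases "L = D") auto
  also have "\<dots> \<longleftrightarrow> (\<exists>i\<in>{1..d div 2}. digraph_iso (with_proj T) (with_proj (path_with_pendents n d i)))"
  proof
    assume "L = D \<and> at_most_one_branch_vertex T"
    moreover from this have "card (leaves T) + (d - 1) = card (pverts T)"
      using assms dn by (simp add: L_def D_def)
    ultimately show "\<exists>i\<in>{1..d div 2}. digraph_iso (with_proj T) (with_proj (path_with_pendents n d i))"
      using extremal_imp_iso[OF assms(1) p] assms(4) by simp
  next
    assume "\<exists>i\<in>{1..d div 2}. digraph_iso (with_proj T) (with_proj (path_with_pendents n d i))"
    then obtain i where i: "i \<in> {1..d div 2}"
      "digraph_iso (with_proj T) (with_proj (path_with_pendents n d i))" by blast
    then have "1 \<le> i" "i < d" by auto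
    \<comment> \<open>The isomorphism yields \<open>D \<le> L\<close>; the diametral path gave the
      other inequality.\<close>
    from iso_imp_extremal[OF this dn i(2)] show "L = D \<and> at_most_one_branch_vertex T"
      using LD assms(1) dn by (simp add: L_def D_def)
  qed
  finally show ?thesis
    unfolding bound using le LD cub by (cases "L = D") auto
qed

end
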